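(* Let $\delta=hD_{con}$, for some $h\in\mathbb{K}[y_2,\dots,y_m]$, and let $\sigma\in\mathbb{S}$. Then the following statements are equivalent. (a) $\delta\sigma(y_1)=\sigma\delta(y_1)$. (b) $\sigma(h)=h$. (c) $\delta\sigma(z)=\sigma\delta(z)$. (d) $\sigma\in\mathrm{Aut}(\delta)$. In particular, if $h\in\mathbb{K}^*$, then $\mathbb{S}$ $(=\mathbb{S}_\delta)$ is a subgroup of $\mathrm{Aut}(\delta)$.
   Context: $\mathbb{K}$ is an algebraically closed field of characteristic zero; $d,m,k_2,\dots,k_m$ are integers $\geqslant 2$. The Danielewski variety with constant coefficients $\mathbb{V}_{con}$ is the affine variety with coordinate ring $\mathbb{K}[\mathbb{V}_{con}]=\mathbb{K}[Y_1,\dots,Y_m,Z]/(Y_1Y_2^{k_2}\cdots Y_m^{k_m}-P(Z))$, where $P(Z)\in\mathbb{K}[Z]$ is monic of degree $d$; $y_1,\dots,y_m,z$ are the images of $Y_1,\dots,Y_m,Z$. The canonical locally nilpotent derivation $D_{con}$ is the $\mathbb{K}$-derivation with $D_{con}(y_1)=P'(z)$, $D_{con}(z)=y_2^{k_2}\cdots y_m^{k_m}$, $D_{con}(y_j)=0$ for $j\geqslant2$. $\mathbb{S}$ (the symmetric group of $\mathbb{V}_{con}$) is the group of automorphisms of $\mathbb{K}[\mathbb{V}_{con}]$ that fix $z$ and permute $y_1,\dots,y_m$ by permutations stabilizing the monomial $Y_1Y_2^{k_2}\cdots Y_m^{k_m}$. $\mathrm{Aut}(\delta)$ is the group of $\mathbb{K}$-algebra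 automorphisms of $\mathbb{K}[\mathbb{V}_{con}]$ commuting with $\delta$, and $\mathbb{S}_\delta=\mathbb{S}\cap\mathrm{Aut}(\delta)$. *)

theory Defs
  imports
    "HOL-Library.Poly_Mapping"
    "HOL-Computational_Algebra.Polynomial"
    "HOL-Combinatorics.Permutations"
    "HOL-Algebra.QuotRing"
    "HOL-Algebra.Bij"
begin

text \<open>
  A monomial is a finitely supported exponent vector, a polynomial a finitely supported
  map from monomials to coefficients, with the convolution product of
  \<^theory>\<open>HOL-Library.Poly_Mapping\<close>. Variables are indexed by natural numbers.
\<close>

type_synonym 'k mpol = "(nat \<Rightarrow>\<^sub>0 nat) \<Rightarrow>\<^sub>0 'k"

definition Const :: "'k::comm_ring_1 \<Rightarrow> 'k mpol" where
  "Const c = Poly_Mapping.single 0 c"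

definition Var :: "nat \<Rightarrow> 'k::comm_ring_1 mpol" where
  "Var i = Poly_Mapping.single (Poly_Mapping.single i 1) 1"

definition vars :: "'k::comm_ring_1 mpol \<Rightarrow> nat set" where
  "vars p = (\<Union>t\<in>Poly_Mapping.keys p. Poly_Mapping.keys t)"

definition mpol_ring :: "nat set \<Rightarrow> 'k::comm_ring_1 mpol ring" where
  "mpol_ring V = \<lparr>carrier = {p. vars p \<subseteq> V}, mult = (*), one = 1, zero = 0, add = (+)\<rparr>"

text \<open>The variable with index 0 is Z, the one with index i in {1..m} is Y_i. The exponent of
  Y_1 in the relator is 1; only the values of k on {2..m} matter.\<close>

abbreviation Z :: "'k::comm_ring_1 mpol" where
  "Z \<equiv> Var 0"

abbreviation Y :: "nat \<Rightarrow> 'k::comm_ring_1 mpol" where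
  "Y i \<equiv> Var i"

definition subst_Z :: "'k::comm_ring_1 poly \<Rightarrow> 'k mpol" where
  "subst_Z P = poly (map_poly Const P) Z"

definition relator :: "nat \<Rightarrow> (nat \<Rightarrow> nat) \<Rightarrow> 'k::comm_ring_1 poly \<Rightarrow> 'k mpol" where
  "relator m k P = Y 1 * (\<Prod>j\<in>{2..m}. Y j ^ k j) - subst_Z P"

definition rel_ideal :: "nat \<Rightarrow> (nat \<Rightarrow> nat) \<Rightarrow> 'k::comm_ring_1 poly \<Rightarrow> 'k mpol set" where
  "rel_ideal m k P = PIdl\<^bsub>mpol_ring {0..m}\<^esub> (relator m k P)"

definition coord_ring :: "nat \<Rightarrow> (nat \<Rightarrow> nat) \<Rightarrow> 'k::comm_ring_1 poly \<Rightarrow> 'k mpol set ring" where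
  "coord_ring m k P = mpol_ring {0..m} Quot rel_ideal m k P"

definition cls :: "nat \<Rightarrow> (nat \<Rightarrow> nat) \<Rightarrow> 'k::comm_ring_1 poly \<Rightarrow> 'k mpol \<Rightarrow> 'k mpol set" where
  "cls m k P p = rel_ideal m k P +>\<^bsub>mpol_ring {0..m}\<^esub> p"

definition derivation ::
    "nat \<Rightarrow> (nat \<Rightarrow> nat) \<Rightarrow> 'k::comm_ring_1 poly \<Rightarrow> ('k mpol set \<Rightarrow> 'k mpol set) \<Rightarrow> bool" where
  "derivation m k P D \<longleftrightarrow>
     (let B = coord_ring m k P in
       D \<in> carrier B \<rightarrow> carrier B \<and>
       (\<forall>a\<in>carrier B. \<forall>b\<in>carrier B. D (a \<oplus>\<^bsub>B\<^esub> b) = D a \<oplus>\<^bsub>B\<^esub> D b) \<and>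
       (\<forall>c. \<forall>b\<in>carrier B.
          D (cls m k P (Const c) \<otimes>\<^bsub>B\<^esub> b) = cls m k P (Const c) \<otimes>\<^bsub>B\<^esub> D b) \<and>
       (\<forall>a\<in>carrier B. \<forall>b\<in>carrier B.
          D (a \<otimes>\<^bsub>B\<^esub> b) = (D a \<otimes>\<^bsub>B\<^esub> b) \<oplus>\<^bsub>B\<^esub> (a \<otimes>\<^bsub>B\<^esub> D b)))"

text \<open>
  The values on the generators determine D on the carrier; it is induced by
  P'(Z) d/dY_1 + Y_2^(k 2) ... Y_m^(k m) d/dZ, which annihilates the relator.
\<close>

definition is_D_con ::
    "nat \<Rightarrow> (nat \<Rightarrow> nat) \<Rightarrow> 'k::idom poly \<Rightarrow> ('k mpol set \<Rightarrow> 'k mpol set) \<Rightarrow> bool" where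
  "is_D_con m k P D \<longleftrightarrow>
     derivation m k P D \<and>
     D (cls m k P (Y 1)) = cls m k P (subst_Z (pderiv P)) \<and>
     D (cls m k P Z) = cls m k P (\<Prod>j\<in>{2..m}. Y j ^ k j) \<and>
     (\<forall>j\<in>{2..m}. D (cls m k P (Y j)) = \<zero>\<^bsub>coord_ring m k P\<^esub>)"

text \<open>
  As in \<^const>\<open>auto\<close>, maps are required to be extensional, so that two automorphisms
  are equal iff they agree on the carrier.
\<close>

definition alg_aut ::
    "nat \<Rightarrow> (nat \<Rightarrow> nat) \<Rightarrow> 'k::comm_ring_1 poly \<Rightarrow> ('k mpol set \<Rightarrow> 'k mpol set) set" where
  "alg_aut m k P =
     {\<sigma> \<in> ring_hom (coord_ring m k P) (coord_ring m k P) \<inter> Bij (carrier (coord_ring m k P)).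
        \<forall>c. \<sigma> (cls m k P (Const c)) = cls m k P (Const c)}"

definition Aut_der ::
    "nat \<Rightarrow> (nat \<Rightarrow> nat) \<Rightarrow> 'k::comm_ring_1 poly \<Rightarrow> ('k mpol set \<Rightarrow> 'k mpol set) \<Rightarrow>
       ('k mpol set \<Rightarrow> 'k mpol set) set" where
  "Aut_der m k P \<delta> =
     {\<sigma> \<in> alg_aut m k P. \<forall>b\<in>carrier (coord_ring m k P). \<delta> (\<sigma> b) = \<sigma> (\<delta> b)}"

definition Aut_der_group ::
    "nat \<Rightarrow> (nat \<Rightarrow> nat) \<Rightarrow> 'k::comm_ring_1 poly \<Rightarrow> ('k mpol set \<Rightarrow> 'k mpol set) \<Rightarrow>
       ('k mpol set \<Rightarrow> 'k mpol set) monoid" where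
  "Aut_der_group m k P \<delta> =
     BijGroup (carrier (coord_ring m k P)) \<lparr>carrier := Aut_der m k P \<delta>\<rparr>"

definition sym_grp ::
    "nat \<Rightarrow> (nat \<Rightarrow> nat) \<Rightarrow> 'k::comm_ring_1 poly \<Rightarrow> ('k mpol set \<Rightarrow> 'k mpol set) set" where
  "sym_grp m k P =
     {\<sigma> \<in> alg_aut m k P.
        \<sigma> (cls m k P Z) = cls m k P Z \<and>
        (\<exists>\<pi>. \<pi> permutes {1..m} \<and>
           Y (\<pi> 1) * (\<Prod>j\<in>{2..m}. Y (\<pi> j) ^ k j) =
             (Y 1 * (\<Prod>j\<in>{2..m}. Y j ^ k j) :: 'k mpol) \<and>
           (\<forall>i\<in>{1..m}. \<sigma> (cls m k P (Y i)) = cls m k P (Y (\<pi> i))))}"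

lemma vars_add: "vars (p + q) \<subseteq> vars p \<union> vars q"
  unfolding vars_def using Poly_Mapping.keys_add[of p q] by blast

lemma vars_mult: "vars (p * q) \<subseteq> vars p \<union> vars q"
proof
  fix i assume "i \<in> vars (p * q)"
  then obtain t where t: "t \<in> Poly_Mapping.keys (p * q)" "i \<in> Poly_Mapping.keys t"
    by (auto simp: vars_def)
  then obtain a b where "t = a + b" "a \<in> Poly_Mapping.keys p" "b \<in> Poly_Mapping.keys q"
    using keys_mult[of p q] by blast
  with t(2) show "i \<in> vars p \<union> vars q"
    using Poly_Mapping.keys_add[of a b] by (auto simp: vars_def)
qed

lemma vars_0 [simp]: "vars 0 = {}"
  by (simp add: vars_def)

lemma vars_Const [simp]: "vars (Const c) = {}"
  by (simp add: vars_def Const_def)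

lemma vars_1 [simp]: "vars 1 = {}"
  by (simp add: vars_def)

lemma vars_uminus [simp]: "vars (- p) = vars p"
  by (simp add: vars_def)

lemma vars_Var [simp]: "vars (Var i :: 'k::comm_ring_1 mpol) = {i}"
  by (simp add: vars_def Var_def)

lemma vars_power: "vars (p ^ n) \<subseteq> vars p"
  using vars_mult by (induction n) fastforce+

lemma vars_prod: "finite A \<Longrightarrow> vars (\<Prod>i\<in>A. f i) \<subseteq> (\<Union>i\<in>A. vars (f i))"
  by (induction A rule: finite_induct) (use vars_mult in fastforce)+

lemma vars_subst_Z: "vars (subst_Z P) \<subseteq> {0}"
  unfolding subst_Z_def
proof (induction P)
  case (pCons a P)
  have "map_poly Const (pCons a P) = pCons (Const a) (map_poly Const P)"
    by (rule poly_eqI) (auto simp: coeff_map_poly Const_def coeff_pCons split: nat.split)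
  then show ?case
    using pCons.IH vars_add[of "Const a" "Z * poly (map_poly Const P) Z"]
      vars_mult[of Z "poly (map_poly Const P) Z"] by auto
qed simp

lemma cring_mpol_ring: "cring (mpol_ring V)"
proof (rule cringI)
  show "abelian_group (mpol_ring V)"
  proof (rule abelian_groupI)
    fix p assume "p \<in> carrier (mpol_ring V)"
    then show "\<exists>q\<in>carrier (mpol_ring V). q \<oplus>\<^bsub>mpol_ring V\<^esub> p = \<zero>\<^bsub>mpol_ring V\<^esub>"
      by (intro bexI[of _ "- p"]) (auto simp: mpol_ring_def)
  qed (use vars_add in \<open>fastforce simp: mpol_ring_def add_ac\<close>)+
  show "comm_monoid (mpol_ring V)"
    by (rule comm_monoidI) (use vars_mult in \<open>fastforce simp: mpol_ring_def mult_ac\<close>)+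
qed (simp add: mpol_ring_def algebra_simps)

lemma relator_in_carrier:
  assumes "1 \<le> m"
  shows "relator m k P \<in> carrier (mpol_ring {0..m})"
proof -
  have "vars (\<Prod>j\<in>{2..m}. Y j ^ k j :: 'a mpol) \<subseteq> (\<Union>j\<in>{2..m}. vars (Y j ^ k j :: 'a mpol))"
    by (rule vars_prod) simp
  also have "\<dots> \<subseteq> {0..m}"
  proof (rule UN_least)
    fix j assume "j \<in> {2..m}"
    then show "vars (Y j ^ k j :: 'a mpol) \<subseteq> {0..m}"
      using vars_power[of "Y j :: 'a mpol" "k j"] by auto
  qed
  finally have "vars (\<Prod>j\<in>{2..m}. Y j ^ k j :: 'a mpol) \<subseteq> {0..m}" .
  then have "vars (Y 1 * (\<Prod>j\<in>{2..m}. Y j ^ k j) :: 'a mpol) \<subseteq> {0..m}"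
    using assms vars_mult[of "Y 1 :: 'a mpol" "\<Prod>j\<in>{2..m}. Y j ^ k j"] by auto
  moreover have "vars (- subst_Z P) \<subseteq> {0..m}"
    using vars_subst_Z[of P] by auto
  ultimately have "vars (Y 1 * (\<Prod>j\<in>{2..m}. Y j ^ k j) + - subst_Z P) \<subseteq> {0..m}"
    using vars_add by blast
  then show ?thesis
    by (simp add: relator_def mpol_ring_def)
qed

lemma rel_ideal_ideal: "1 \<le> m \<Longrightarrow> ideal (rel_ideal m k P) (mpol_ring {0..m})"
  unfolding rel_ideal_def
  by (intro cring.cgenideal_ideal cring_mpol_ring relator_in_carrier)

lemma cring_coord_ring: "1 \<le> m \<Longrightarrow> cring (coord_ring m k P)"
  unfolding coord_ring_def by (intro ideal.quotient_is_cring rel_ideal_ideal cring_mpol_ring)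

lemma cls_ring_hom:
  "1 \<le> m \<Longrightarrow> cls m k P \<in> ring_hom (mpol_ring {0..m}) (coord_ring m k P)"
  using ideal.rcos_ring_hom[OF rel_ideal_ideal] unfolding coord_ring_def cls_def by blast

lemma Aut_der_subgroup:
  assumes m: "1 \<le> m" and \<delta>: "\<delta> \<in> carrier (coord_ring m k P) \<rightarrow> carrier (coord_ring m k P)"
  shows "subgroup (Aut_der m k P \<delta>) (BijGroup (carrier (coord_ring m k P)))"
proof -
  define B where "B = coord_ring m k P"
  interpret B: cring B unfolding B_def by (rule cring_coord_ring[OF m])
  have cst: "cls m k P (Const c) \<in> carrier B" for c
    using ring_hom_closed[OF cls_ring_hom[OF m], of "Const c" k P]
    by (simp add: mpol_ring_def B_def)
  have \<delta>B: "\<delta> b \<in> carrier B" if "b \<in> carrier B" for b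
    using \<delta> that by (auto simp: B_def)
  have iff: "\<sigma> \<in> Aut_der m k P \<delta> \<longleftrightarrow> \<sigma> \<in> ring_hom B B \<and> \<sigma> \<in> Bij (carrier B) \<and>
      (\<forall>c. \<sigma> (cls m k P (Const c)) = cls m k P (Const c)) \<and>
      (\<forall>b\<in>carrier B. \<delta> (\<sigma> b) = \<sigma> (\<delta> b))" for \<sigma>
    by (auto simp: Aut_der_def alg_aut_def B_def)
  have "subgroup (Aut_der m k P \<delta>) (BijGroup (carrier B))"
  proof (rule subgroup.intro)
    show "Aut_der m k P \<delta> \<subseteq> carrier (BijGroup (carrier B))"
      by (auto simp: iff BijGroup_def)
  next
    fix f g assume f: "f \<in> Aut_der m k P \<delta>" and g: "g \<in> Aut_der m k P \<delta>"
    have cl: "g b \<in> carrier B" "f b \<in> carrier B" if "b \<in> carrier B" for b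
      using f g that by (auto simp: iff ring_hom_closed)
    have "compose (carrier B) f g \<in> ring_hom B B"
      using f g cl by (auto simp: iff compose_def ring_hom_def)
    moreover have "compose (carrier B) f g \<in> Bij (carrier B)"
      using f g by (simp add: iff compose_Bij)
    ultimately show "f \<otimes>\<^bsub>BijGroup (carrier B)\<^esub> g \<in> Aut_der m k P \<delta>"
      using f g cl by (simp add: iff BijGroup_def compose_eq cst \<delta>B)
  next
    show "\<one>\<^bsub>BijGroup (carrier B)\<^esub> \<in> Aut_der m k P \<delta>"
      by (auto simp: iff BijGroup_def id_Bij cst \<delta>B ring_hom_def)
  next
    fix f assume f: "f \<in> Aut_der m k P \<delta>"
    let ?g = "\<lambda>x\<in>carrier B. inv_into (carrier B) f x"
    have fB: "f \<in> Bij (carrier B)" and fh: "f \<in> ring_hom B B" using f by (auto simp: iff)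
    have img: "f ` carrier B = carrier B" and inj: "inj_on f (carrier B)"
      using fB by (auto simp: Bij_def bij_betw_def)
    have gB: "?g b \<in> carrier B" if "b \<in> carrier B" for b
      using that fB by (simp add: Bij_inv_into_mem)
    have fg: "f (?g b) = b" if "b \<in> carrier B" for b
      using that img by (simp add: f_inv_into_f)
    have gI: "?g b = a" if "a \<in> carrier B" "f a = b" for a b
      using that inj img by auto
    have "?g \<in> ring_hom B B"
    proof (rule ring_hom_memI)
      fix x y assume xy: "x \<in> carrier B" "y \<in> carrier B"
      show "?g (x \<otimes>\<^bsub>B\<^esub> y) = ?g x \<otimes>\<^bsub>B\<^esub> ?g y"
        by (rule gI) (use xy gB fg ring_hom_mult[OF fh gB gB] in \<open>simp_all del: restrict_apply\<close>)
      show "?g (x \<oplus>\<^bsub>B\<^esub> y) = ?g x \<oplus>\<^bsub>B\<^esub> ?g y"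
        by (rule gI) (use xy gB fg ring_hom_add[OF fh gB gB] in \<open>simp_all del: restrict_apply\<close>)
      show "?g x \<in> carrier B" by (rule gB) fact
    next
      show "?g \<one>\<^bsub>B\<^esub> = \<one>\<^bsub>B\<^esub>"
        by (rule gI) (use ring_hom_one[OF fh] in simp_all)
    qed
    moreover have "?g (cls m k P (Const c)) = cls m k P (Const c)" for c
      by (rule gI) (use f cst in \<open>auto simp: iff\<close>)
    moreover have "\<delta> (?g b) = ?g (\<delta> b)" if b: "b \<in> carrier B" for b
    proof (rule gI[symmetric])
      show "\<delta> (?g b) \<in> carrier B" by (intro \<delta>B gB b)
      show "f (\<delta> (?g b)) = \<delta> b"
        using f gB[OF b] fg[OF b] by (metis iff)
    qed
    ultimately have "?g \<in> Aut_der m k P \<delta>"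
      using restrict_inv_into_Bij[OF fB] by (simp only: iff) blast
    then show "inv\<^bsub>BijGroup (carrier B)\<^esub> f \<in> Aut_der m k P \<delta>"
      using fB by (simp only: inv_BijGroup)
  qed
  then show ?thesis by (simp add: B_def)
qed

lemma group_Aut_der_group:
  assumes "1 \<le> m" and "\<delta> \<in> carrier (coord_ring m k P) \<rightarrow> carrier (coord_ring m k P)"
  shows "group (Aut_der_group m k P \<delta>)"
  unfolding Aut_der_group_def
  by (intro subgroup.subgroup_is_group Aut_der_subgroup assms group_BijGroup)

end

theory Submission
  imports Defs
begin

text \<open>
  As 1 is the exponent of Y_1 only, the permutation behind \<sigma> fixes 1. Hence \<sigma> fixes y_1, z and the
  monomial D(z) = y_2^(k 2) ... y_m^(k m), and \<delta>\<sigma> - \<sigma>\<delta> takes the value (h - \<sigma>(h)) r at y_1 and at z, with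
  r = P'(z) and r = D(z) respectively. Both r have Z-degree less than that of P, whereas every
  nonzero multiple of the relator has Z-degree at least that of P. So (h - \<sigma>(h)) r = 0 already holds
  in the polynomial ring, which is a domain, and (a) and (c) each force \<sigma>(h) = h. Conversely, if
  \<sigma>(h) = h then \<delta> and \<sigma> commute on the generators, and so everywhere by the Leibniz rule.
\<close>

section \<open>Polynomials in finitely many variables\<close>

lemma single_sum_eq_prod:
  "Poly_Mapping.single (sum f A) (1 :: 'k::comm_ring_1) = (\<Prod>i\<in>A. Poly_Mapping.single (f i) 1)"
proof (induction A rule: infinite_finite_induct)
  case (insert a A)
  then show ?case by (simp add: mult_single flip: insert.IH)
qed simp_all

lemma Var_power: "Var i ^ n = Poly_Mapping.single (Poly_Mapping.single i n) (1 :: 'k::comm_ring_1)"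
  by (induction n) (simp_all add: Var_def mult_single flip: single_add)

lemma prod_Var_power:
  "(\<Prod>i\<in>A. Var i ^ e i :: 'k::comm_ring_1 mpol) =
     Poly_Mapping.single (\<Sum>i\<in>A. Poly_Mapping.single i (e i)) 1"
  by (simp add: Var_power single_sum_eq_prod)

lemma lookup_sum_single:
  "finite A \<Longrightarrow> Poly_Mapping.lookup (\<Sum>i\<in>A. Poly_Mapping.single i (e i)) j = (if j \<in> A then e j else 0)"
  by (simp add: lookup_sum lookup_single when_def)

lemma poly_mapping_expansion:
  "p = (\<Sum>t\<in>Poly_Mapping.keys p. Poly_Mapping.single t (Poly_Mapping.lookup p t))"
  by (rule poly_mapping_eqI) (simp add: lookup_sum_single in_keys_iff)

text \<open>Every polynomial is a finite sum of products of a constant and powers of variables from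
  \<open>V\<close>. The bounds on \<open>vars\<close> in the cases \<open>add\<close> and
  \<open>mult\<close> let ring homomorphism laws that hold only on the carrier be applied
  there.\<close>

lemma mpol_induct [consumes 1, case_names Const Var add mult]:
  assumes "vars p \<subseteq> V"
    and Const: "\<And>c. Q (Const c)"
    and Var: "\<And>i. i \<in> V \<Longrightarrow> Q (Var i)"
    and add: "\<And>p q. vars p \<subseteq> V \<Longrightarrow> vars q \<subseteq> V \<Longrightarrow> Q p \<Longrightarrow> Q q \<Longrightarrow> Q (p + q)"
    and mult: "\<And>p q. vars p \<subseteq> V \<Longrightarrow> vars q \<subseteq> V \<Longrightarrow> Q p \<Longrightarrow> Q q \<Longrightarrow> Q (p * q)"
  shows "Q (p :: 'k::comm_ring_1 mpol)"
proof -
  \<comment> \<open>Bundling the bound on the variables with \<open>Q\<close> makes \<open>R\<close>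
    closed under sums and products without side conditions.\<close>
  define R where "R p \<longleftrightarrow> vars p \<subseteq> V \<and> Q p" for p
  have R_Const: "R (Const c)" for c
    using Const by (simp add: R_def)
  have R0: "R 0" and R1: "R 1"
    using R_Const[of 0] R_Const[of 1] by (simp_all add: Const_def)
  have R_add: "R (p + q)" if "R p" "R q" for p q
    using that add vars_add[of p q] by (auto simp: R_def)
  have R_mult: "R (p * q)" if "R p" "R q" for p q
    using that mult vars_mult[of p q] by (auto simp: R_def)
  have R_power: "R (Var i ^ n)" if "i \<in> V" for i n
    by (induction n) (use that Var R1 R_mult in \<open>auto simp: R_def\<close>)
  have R_prod: "R (\<Prod>i\<in>A. Var i ^ e i)" if "A \<subseteq> V" for A e
    using that by (induction A rule: infinite_finite_induct) (auto intro: R1 R_mult R_power)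
  have R_single: "R (Poly_Mapping.single t c)" if t: "Poly_Mapping.keys t \<subseteq> V" for t c
  proof -
    have "Poly_Mapping.single t c = Const c * Poly_Mapping.single t 1"
      by (simp add: Const_def mult_single)
    also have "Poly_Mapping.single t 1 =
        (\<Prod>i\<in>Poly_Mapping.keys t. Var i ^ Poly_Mapping.lookup t i :: 'k mpol)"
      by (simp add: prod_Var_power flip: poly_mapping_expansion)
    finally show ?thesis
      using t by (simp add: R_mult R_Const R_prod)
  qed
  have "R (\<Sum>t\<in>A. Poly_Mapping.single t (c t))" if "\<forall>t\<in>A. Poly_Mapping.keys t \<subseteq> V" for A c
    using that by (induction A rule: infinite_finite_induct) (auto intro: R0 R_add R_single)
  from this[of "Poly_Mapping.keys p" "Poly_Mapping.lookup p"] have "R p"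
    using assms(1) by (subst poly_mapping_expansion) (auto simp: vars_def)
  then show ?thesis by (simp add: R_def)
qed

lemma subst_Z_0 [simp]: "subst_Z 0 = 0"
  by (simp add: subst_Z_def)

lemma subst_Z_pCons: "subst_Z (pCons a P) = Const a + Z * subst_Z P"
proof -
  have "map_poly Const (pCons a P) = pCons (Const a) (map_poly Const P)"
    by (rule poly_eqI) (auto simp: coeff_map_poly Const_def coeff_pCons split: nat.split)
  then show ?thesis by (simp add: subst_Z_def)
qed

lemma subst_Z_altdef:
  "subst_Z P = (\<Sum>i\<le>degree P. Poly_Mapping.single (Poly_Mapping.single 0 i) (coeff P i))"
proof -
  have "degree (map_poly Const P) = degree P"
    by (rule degree_map_poly) (metis Const_def lookup_single_eq lookup_zero)
  then show ?thesis
    by (simp add: subst_Z_def poly_altdef coeff_map_poly Const_def Var_power mult_single)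
qed

lemma lookup_subst_Z: "Poly_Mapping.lookup (subst_Z P) (Poly_Mapping.single 0 n) = coeff P n"
proof -
  have "Poly_Mapping.lookup (subst_Z P) (Poly_Mapping.single 0 n) =
      (\<Sum>i\<le>degree P. if i = n then coeff P i else 0)"
    \<comment> \<open>Evaluating exponent vectors at 0 shows that distinct powers of Z are distinct
      monomials.\<close>
    unfolding subst_Z_altdef lookup_sum by (rule sum.cong) (auto simp: lookup_single when_def dest: arg_cong[of _ _ "\<lambda>t. Poly_Mapping.lookup t 0"])
  then show ?thesis by (auto simp: coeff_eq_0)
qed

lemma keys_subst_Z: "Poly_Mapping.keys (subst_Z P) \<subseteq> Poly_Mapping.single 0 ` {..degree P}"
  unfolding subst_Z_altdef by (rule order_trans[OF keys_sum]) auto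

lemma subst_Z_eq_0_iff [simp]: "subst_Z P = 0 \<longleftrightarrow> P = 0"
  by (metis lookup_subst_Z lookup_zero leading_coeff_0_iff subst_Z_0)

section \<open>Leading monomials\<close>

text \<open>The product of the leading terms cannot cancel: any other pair of monomials has a
  strictly smaller sum, and the product of the two leading coefficients is nonzero in a
  domain.\<close>

lemma Max_keys_add_in_keys_mult:
  fixes f g :: "'a::{ordered_cancel_comm_monoid_add, linorder} \<Rightarrow>\<^sub>0 'b::idom"
  assumes "f \<noteq> 0" "g \<noteq> 0"
  shows "Max (Poly_Mapping.keys f) + Max (Poly_Mapping.keys g) \<in> Poly_Mapping.keys (f * g)"
proof -
  define s t where "s = Max (Poly_Mapping.keys f)" and "t = Max (Poly_Mapping.keys g)"
  have s: "s \<in> Poly_Mapping.keys f" "\<And>a. a \<in> Poly_Mapping.keys f \<Longrightarrow> a \<le> s"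
    using assms by (auto simp: s_def)
  have t: "t \<in> Poly_Mapping.keys g" "\<And>a. a \<in> Poly_Mapping.keys g \<Longrightarrow> a \<le> t"
    using assms by (auto simp: t_def)
  define f0 g0 where "f0 = Poly_Mapping.single s (Poly_Mapping.lookup f s)"
    and "g0 = Poly_Mapping.single t (Poly_Mapping.lookup g t)"
  have f': "a < s" if "a \<in> Poly_Mapping.keys (f - f0)" for a
    using that s(2)[of a] by (auto simp: f0_def in_keys_iff lookup_minus lookup_single when_def split: if_splits)
  have g': "a < t" if "a \<in> Poly_Mapping.keys (g - g0)" for a
    using that t(2)[of a] by (auto simp: g0_def in_keys_iff lookup_minus lookup_single when_def split: if_splits)
  have f0: "Poly_Mapping.keys f0 \<subseteq> {s}" by (simp add: f0_def)
  have "s + t \<notin> Poly_Mapping.keys ((f - f0) * g)"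
  proof
    assume "s + t \<in> Poly_Mapping.keys ((f - f0) * g)"
    then obtain a b where "s + t = a + b" "a \<in> Poly_Mapping.keys (f - f0)" "b \<in> Poly_Mapping.keys g"
      using keys_mult by blast
    then show False using f' t(2) add_less_le_mono[of a s b t] by force
  qed
  moreover have "s + t \<notin> Poly_Mapping.keys (f0 * (g - g0))"
  proof
    assume "s + t \<in> Poly_Mapping.keys (f0 * (g - g0))"
    then obtain a b where "s + t = a + b" "a \<in> Poly_Mapping.keys f0" "b \<in> Poly_Mapping.keys (g - g0)"
      using keys_mult by blast
    then show False using f0 g' add_strict_left_mono[of b t s] by force
  qed
  \<comment> \<open>With the leading terms \<open>f0\<close> and \<open>g0\<close> split off, only
    the first summand can contribute at \<open>s + t\<close>.\<close>
  moreover have "f * g = f0 * g0 + (f - f0) * g + f0 * (g - g0)"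
    by (simp add: algebra_simps)
  ultimately have "Poly_Mapping.lookup (f * g) (s + t) = Poly_Mapping.lookup (f0 * g0) (s + t)"
    by (simp add: lookup_add in_keys_iff)
  also have "\<dots> \<noteq> 0"
    using s(1) t(1) by (simp add: f0_def g0_def mult_single in_keys_iff)
  finally show ?thesis by (simp add: in_keys_iff s_def t_def)
qed

text \<open>In the lexicographic order of monomials the variable with index 0, i.e. Z, is the most
  significant one.\<close>

lemma lookup_0_mono:
  fixes s t :: "nat \<Rightarrow>\<^sub>0 nat"
  assumes "s \<le> t"
  shows "Poly_Mapping.lookup s 0 \<le> Poly_Mapping.lookup t 0"
  using assms
proof (transfer)
  fix s t :: "nat \<Rightarrow> nat"
  assume "less_fun s t \<or> s = t"
  then show "s 0 \<le> t 0"
    \<comment> \<open>At the first index where \<open>s\<close> and \<open>t\<close> differ,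
      \<open>s\<close> is smaller. Either this index is 0, or the values at 0 agree.\<close>
    by (metis less_fun_def gr0I le_refl less_imp_le)
qed

text \<open>The witness is the leading monomial of the product: its Z-exponent is at least that of
  the leading monomial of \<open>f\<close>, where the Z-exponent is largest. Hence nonzero multiples
  of the relator keep its Z-degree as a lower bound.\<close>

lemma degree_Z_mult:
  fixes f g :: "'k::idom mpol"
  assumes "f * g \<noteq> 0" and "s \<in> Poly_Mapping.keys f"
  shows "\<exists>t\<in>Poly_Mapping.keys (f * g). Poly_Mapping.lookup s 0 \<le> Poly_Mapping.lookup t 0"
proof
  show "Max (Poly_Mapping.keys f) + Max (Poly_Mapping.keys g) \<in> Poly_Mapping.keys (f * g)"
    using assms(1) by (intro Max_keys_add_in_keys_mult) auto
  show "Poly_Mapping.lookup s 0 \<le>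
      Poly_Mapping.lookup (Max (Poly_Mapping.keys f) + Max (Poly_Mapping.keys g)) 0"
    using lookup_0_mono[OF Max_ge[OF finite_keys assms(2)]] by (simp add: lookup_add)
qed

section \<open>The monomial of the relator\<close>

text \<open>The update \<open>k(1 := 1)\<close> supplies the exponent of Y_1, so that all variables
  can be treated in one product.\<close>

lemma relator_monomial:
  fixes m :: nat
  assumes "1 \<le> m"
  shows "Y (\<pi> 1) * (\<Prod>j\<in>{2..m}. Y (\<pi> j) ^ k j) = (\<Prod>j\<in>{1..m}. Y (\<pi> j) ^ (k(1 := 1)) j)"
proof -
  have "{1..m} = insert 1 {2..m}" using assms by auto
  then show ?thesis by (auto intro!: prod.cong)
qed

text \<open>A monomial determines its exponent vector, so stabilizing it means preserving exponents.
  This form is convenient for composition and inversion of permutations.\<close>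

lemma permuted_monomial_eq_iff:
  fixes m :: nat
  assumes "1 \<le> m" and \<pi>: "\<pi> permutes {1..m}"
  shows "Y (\<pi> 1) * (\<Prod>j\<in>{2..m}. Y (\<pi> j) ^ k j) =
      (Y 1 * (\<Prod>j\<in>{2..m}. Y j ^ k j) :: 'k::comm_ring_1 mpol) \<longleftrightarrow>
    (\<forall>j\<in>{1..m}. (k(1 := 1)) (\<pi> j) = (k(1 := 1)) j)"
proof -
  define e where "e = k(1 := 1)"
  have \<pi>j: "\<pi> j \<in> {1..m} \<longleftrightarrow> j \<in> {1..m}" for j
    using permutes_in_image[OF \<pi>] .
  \<comment> \<open>Reindexing moves the permutation from the variables to the exponents.\<close>
  have "(\<Prod>j\<in>{1..m}. Y (\<pi> j) ^ e j) = (\<Prod>j\<in>{1..m}. Y j ^ e (inv_into UNIV \<pi> j) :: 'k mpol)"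
    using permutes_inverses(2)[OF \<pi>] by (subst prod.permute[OF \<pi>]) (simp add: o_def)
  moreover have "(\<Prod>j\<in>{1..m}. Y j ^ e (inv_into UNIV \<pi> j)) = (\<Prod>j\<in>{1..m}. Y j ^ e j :: 'k mpol) \<longleftrightarrow>
      (\<forall>j\<in>{1..m}. e (inv_into UNIV \<pi> j) = e j)"
  proof
    assume "(\<Prod>j\<in>{1..m}. Y j ^ e (inv_into UNIV \<pi> j)) = (\<Prod>j\<in>{1..m}. Y j ^ e j :: 'k mpol)"
    then have eq: "(\<Sum>j\<in>{1..m}. Poly_Mapping.single j (e (inv_into UNIV \<pi> j))) =
        (\<Sum>j\<in>{1..m}. Poly_Mapping.single j (e j))"
      \<comment> \<open>Both sides are single terms with coefficient 1, so their sets of keys are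
        singletons holding the exponent vectors.\<close>
      unfolding prod_Var_power by (auto dest: arg_cong[of _ _ Poly_Mapping.keys])
    show "\<forall>j\<in>{1..m}. e (inv_into UNIV \<pi> j) = e j"
    proof
      fix j assume "j \<in> {1..m}"
      then show "e (inv_into UNIV \<pi> j) = e j"
        using arg_cong[OF eq, of "\<lambda>s. Poly_Mapping.lookup s j"] by (simp add: lookup_sum_single)
    qed
  qed simp
  moreover have "(\<forall>j\<in>{1..m}. e (inv_into UNIV \<pi> j) = e j) \<longleftrightarrow> (\<forall>j\<in>{1..m}. e (\<pi> j) = e j)"
  proof (intro iffI ballI)
    fix j assume "\<forall>j\<in>{1..m}. e (inv_into UNIV \<pi> j) = e j" "j \<in> {1..m}"
    then have "e (inv_into UNIV \<pi> (\<pi> j)) = e (\<pi> j)" using \<pi>j by blast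
    then show "e (\<pi> j) = e j" by (simp add: permutes_inverses(2)[OF \<pi>])
  next
    fix j assume *: "\<forall>j\<in>{1..m}. e (\<pi> j) = e j" "j \<in> {1..m}"
    have "inv_into UNIV \<pi> j \<in> {1..m}"
      using *(2) \<pi>j[of "inv_into UNIV \<pi> j"] by (simp add: permutes_inverses(1)[OF \<pi>])
    then have "e (\<pi> (inv_into UNIV \<pi> j)) = e (inv_into UNIV \<pi> j)" using *(1) by blast
    then show "e (inv_into UNIV \<pi> j) = e j" by (simp add: permutes_inverses(1)[OF \<pi>])
  qed
  ultimately show ?thesis
    using relator_monomial[OF assms(1), of \<pi> k, where 'a = 'k]
      relator_monomial[OF assms(1), of "\<lambda>i. i" k, where 'a = 'k]
    by (simp add: e_def)
qed

section \<open>The coordinate ring\<close>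

locale danielewski =
  fixes m :: nat and k :: "nat \<Rightarrow> nat" and P :: "'k::idom poly"
  assumes m_ge_1: "1 \<le> m"
begin

abbreviation B :: "'k mpol set ring" where "B \<equiv> coord_ring m k P"
abbreviation cl :: "'k mpol \<Rightarrow> 'k mpol set" where "cl \<equiv> cls m k P"

sublocale B: cring B by (rule cring_coord_ring[OF m_ge_1])

lemma cl_closed [simp]: "vars p \<subseteq> {0..m} \<Longrightarrow> cl p \<in> carrier B"
  using ring_hom_closed[OF cls_ring_hom[OF m_ge_1]] by (simp add: mpol_ring_def)

lemma cl_add: "vars p \<subseteq> {0..m} \<Longrightarrow> vars q \<subseteq> {0..m} \<Longrightarrow> cl (p + q) = cl p \<oplus>\<^bsub>B\<^esub> cl q"
  using ring_hom_add[OF cls_ring_hom[OF m_ge_1], of p q k P] by (simp add: mpol_ring_def)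

lemma cl_mult: "vars p \<subseteq> {0..m} \<Longrightarrow> vars q \<subseteq> {0..m} \<Longrightarrow> cl (p * q) = cl p \<otimes>\<^bsub>B\<^esub> cl q"
  using ring_hom_mult[OF cls_ring_hom[OF m_ge_1], of p q k P] by (simp add: mpol_ring_def)

lemma cl_1: "cl 1 = \<one>\<^bsub>B\<^esub>"
  using ring_hom_one[OF cls_ring_hom[OF m_ge_1], of k P] by (simp add: mpol_ring_def)

lemma cl_0: "cl 0 = \<zero>\<^bsub>B\<^esub>"
proof -
  have "cl 0 = cl 0 \<oplus>\<^bsub>B\<^esub> cl 0" using cl_add[of 0 0] by simp
  then show ?thesis using cl_closed[of 0] by simp
qed

lemma coord_ring_surj:
  assumes "b \<in> carrier B"
  obtains p where "vars p \<subseteq> {0..m}" "b = cl p"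
  using assms
  by (auto simp: coord_ring_def FactRing_def A_RCOSETS_def' cls_def mpol_ring_def)

text \<open>This is \<open>mpol_induct\<close> carried along the quotient map, with the variable of
  index 0 split off as Z. It reduces identities on the whole ring to the generators.\<close>

lemma coord_ring_induct [consumes 1, case_names Const Z Y add mult]:
  assumes "b \<in> carrier B"
    and "\<And>c. Q (cl (Const c))" "Q (cl Z)" "\<And>j. j \<in> {1..m} \<Longrightarrow> Q (cl (Y j))"
    and "\<And>a b. a \<in> carrier B \<Longrightarrow> b \<in> carrier B \<Longrightarrow> Q a \<Longrightarrow> Q b \<Longrightarrow> Q (a \<oplus>\<^bsub>B\<^esub> b)"
    and "\<And>a b. a \<in> carrier B \<Longrightarrow> b \<in> carrier B \<Longrightarrow> Q a \<Longrightarrow> Q b \<Longrightarrow> Q (a \<otimes>\<^bsub>B\<^esub> b)"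
  shows "Q b"
proof -
  obtain p where p: "vars p \<subseteq> {0..m}" "b = cl p"
    using assms(1) by (rule coord_ring_surj)
  from p(1) have "Q (cl p)"
  proof (induction rule: mpol_induct)
    case (Var i)
    then show ?case using assms(3,4) by (cases "i = 0") auto
  qed (simp_all add: assms cl_add cl_mult)
  with p(2) show ?thesis by simp
qed

lemma cl_eqD:
  assumes "vars p \<subseteq> {0..m}" "vars q \<subseteq> {0..m}" "cl p = cl q"
  obtains g where "p - q = relator m k P * g"
proof -
  interpret R: cring "mpol_ring {0..m} :: 'k mpol ring" by (rule cring_mpol_ring)
  interpret I: ideal "rel_ideal m k P" "mpol_ring {0..m}" by (rule rel_ideal_ideal[OF m_ge_1])
  have "p \<in> cl q"
    using I.a_rcos_self[of p] assms by (simp add: cls_def mpol_ring_def)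
  then have "\<exists>g. p = g * relator m k P + q"
    by (auto simp: cls_def a_r_coset_def' rel_ideal_def cgenideal_def mpol_ring_def)
  then obtain g where "p = g * relator m k P + q" ..
  then have "p - q = relator m k P * g" by (simp add: mult.commute)
  then show ?thesis by (rule that)
qed

text \<open>The monomial of the relator contains Y_1, so it cannot cancel the leading term of
  P(Z).\<close>

lemma single_Z_in_keys_relator:
  assumes "P \<noteq> 0"
  shows "Poly_Mapping.single 0 (degree P) \<in> Poly_Mapping.keys (relator m k P)"
proof -
  define t where "t = (\<Sum>j\<in>{1..m}. Poly_Mapping.single j ((k(1 := 1)) j))"
  have "Poly_Mapping.lookup t 1 = 1"
    using m_ge_1 by (simp add: t_def lookup_sum_single)
  then have "t \<noteq> Poly_Mapping.single 0 (degree P)"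
    by (auto simp: lookup_single)
  moreover have "relator m k P = Poly_Mapping.single t 1 - subst_Z P"
    using relator_monomial[OF m_ge_1, of "\<lambda>i. i" k] by (simp add: relator_def prod_Var_power t_def)
  ultimately show ?thesis
    using assms by (simp add: in_keys_iff lookup_minus lookup_single lookup_subst_Z)
qed

text \<open>The difference is a multiple of the relator; if nonzero, it would contain a monomial of
  Z-degree at least \<open>degree P\<close> by \<open>degree_Z_mult\<close>.\<close>

lemma cl_eq_imp_eq:
  assumes "P \<noteq> 0" and "vars p \<subseteq> {0..m}" "vars q \<subseteq> {0..m}" "cl p = cl q"
    and deg: "\<And>t. t \<in> Poly_Mapping.keys (p - q) \<Longrightarrow> Poly_Mapping.lookup t 0 < degree P"
  shows "p = q"
proof (rule ccontr)
  obtain g where g: "p - q = relator m k P * g"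
    using assms(2-4) by (rule cl_eqD)
  assume "p \<noteq> q"
  then have "relator m k P * g \<noteq> 0" using g right_minus_eq by metis
  from degree_Z_mult[OF this single_Z_in_keys_relator[OF \<open>P \<noteq> 0\<close>]] deg g
  show False unfolding g[symmetric] using deg by (force simp: lookup_single not_less)
qed

text \<open>As \<open>p\<close> and \<open>q\<close> do not involve Z, multiplying \<open>r\<close>
  by their difference does not raise its Z-degree. The equation therefore lifts to polynomials,
  where \<open>r\<close> can be cancelled.\<close>

lemma cl_mult_right_cancel:
  assumes "vars p \<subseteq> {2..m}" "vars q \<subseteq> {2..m}" "vars r \<subseteq> {0..m}" and "r \<noteq> 0"
    and deg: "\<And>t. t \<in> Poly_Mapping.keys r \<Longrightarrow> Poly_Mapping.lookup t 0 < degree P"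
  shows "cl p \<otimes>\<^bsub>B\<^esub> cl r = cl q \<otimes>\<^bsub>B\<^esub> cl r \<longleftrightarrow> cl p = cl q"
proof
  assume eq: "cl p \<otimes>\<^bsub>B\<^esub> cl r = cl q \<otimes>\<^bsub>B\<^esub> cl r"
  have pq: "vars p \<subseteq> {0..m}" "vars q \<subseteq> {0..m}" using assms by auto
  \<comment> \<open>For \<open>P = 0\<close> the strict degree bound would leave \<open>r\<close>
    without any monomial.\<close>
  have "P \<noteq> 0"
  proof
    assume "P = 0"
    then have "Poly_Mapping.keys r = {}" using deg by force
    then show False using \<open>r \<noteq> 0\<close> by simp
  qed
  have "p * r = q * r"
  proof (rule cl_eq_imp_eq[OF \<open>P \<noteq> 0\<close>])
    show "vars (p * r) \<subseteq> {0..m}" "vars (q * r) \<subseteq> {0..m}"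
      using pq assms(3) vars_mult by blast+
    show "cl (p * r) = cl (q * r)"
      using eq pq assms(3) by (simp add: cl_mult)
    fix t assume "t \<in> Poly_Mapping.keys (p * r - q * r)"
    then have "t \<in> Poly_Mapping.keys ((p - q) * r)" by (simp add: algebra_simps)
    then obtain a b where ab: "t = a + b" "a \<in> Poly_Mapping.keys (p - q)" "b \<in> Poly_Mapping.keys r"
      using keys_mult by blast
    have "vars (p - q) \<subseteq> {2..m}"
      using vars_add[of p "- q"] assms(1,2) by auto
    then have "Poly_Mapping.lookup a 0 = 0"
      using ab(2) by (force simp: vars_def in_keys_iff)
    then show "Poly_Mapping.lookup t 0 < degree P"
      using ab deg by (simp add: lookup_add)
  qed
  then show "cl p = cl q" using \<open>r \<noteq> 0\<close> by simp
qed simp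

lemma vars_prod_Y: "A \<subseteq> {0..m} \<Longrightarrow> vars (\<Prod>j\<in>A. Y j ^ e j :: 'k mpol) \<subseteq> A"
  unfolding prod_Var_power vars_def
  by (auto simp: in_keys_iff lookup_sum_single finite_subset split: if_splits)

lemma alg_aut_hom: "\<sigma> \<in> alg_aut m k P \<Longrightarrow> ring_hom_cring B B \<sigma>"
  by unfold_locales (auto simp: alg_aut_def)

text \<open>Constants and z are fixed, and Horner's scheme builds every polynomial in z from them.
  This will be applied to P'(z).\<close>

lemma alg_aut_subst_Z:
  assumes \<sigma>: "\<sigma> \<in> alg_aut m k P" and "\<sigma> (cl Z) = cl Z"
  shows "\<sigma> (cl (subst_Z Q)) = cl (subst_Z Q)"
proof -
  interpret ring_hom_cring B B \<sigma> by (rule alg_aut_hom[OF \<sigma>])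
  have vQ: "vars (subst_Z Q) \<subseteq> {0..m}" for Q :: "'k poly"
    using vars_subst_Z by fastforce
  show ?thesis
  proof (induction Q)
    case (pCons a Q)
    have "vars (Z * subst_Z Q) \<subseteq> {0..m}"
      using vQ vars_mult[of Z "subst_Z Q"] by fastforce
    then show ?case
      using pCons.IH vQ assms by (simp add: subst_Z_pCons cl_add cl_mult alg_aut_def)
  qed (simp add: cl_0)
qed

text \<open>Replaces the equation of monomials by invariance of the exponents; the equivalence holds
  only under \<open>\<pi> permutes {1..m}\<close>, hence the conjunction congruence rule.\<close>

lemma sym_grp_iff:
  "\<sigma> \<in> sym_grp m k P \<longleftrightarrow> \<sigma> \<in> alg_aut m k P \<and> \<sigma> (cl Z) = cl Z \<and>
     (\<exists>\<pi>. \<pi> permutes {1..m} \<and> (\<forall>j\<in>{1..m}. (k(1 := 1)) (\<pi> j) = (k(1 := 1)) j) \<and>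
        (\<forall>i\<in>{1..m}. \<sigma> (cl (Y i)) = cl (Y (\<pi> i))))"
  unfolding sym_grp_def mem_Collect_eq
  using permuted_monomial_eq_iff[OF m_ge_1, where 'k = 'k and k = k] by (simp cong: conj_cong)

lemma sym_grpE:
  assumes "\<sigma> \<in> sym_grp m k P"
  obtains \<pi> where "\<sigma> \<in> alg_aut m k P" "\<sigma> (cl Z) = cl Z" "\<pi> permutes {1..m}"
    "\<forall>j\<in>{1..m}. (k(1 := 1)) (\<pi> j) = (k(1 := 1)) j"
    "\<forall>i\<in>{1..m}. \<sigma> (cl (Y i)) = cl (Y (\<pi> i))"
  using assms unfolding sym_grp_iff by (elim conjE exE) (rule that)

lemma alg_aut_prod_Y:
  assumes \<sigma>: "\<sigma> \<in> alg_aut m k P"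
    and A: "A \<subseteq> {1..m}" and \<pi>: "\<pi> ` A \<subseteq> {1..m}" and \<sigma>Y: "\<And>i. i \<in> A \<Longrightarrow> \<sigma> (cl (Y i)) = cl (Y (\<pi> i))"
  shows "\<sigma> (cl (\<Prod>j\<in>A. Y j ^ e j)) = cl (\<Prod>j\<in>A. Y (\<pi> j) ^ e j)"
proof -
  interpret ring_hom_cring B B \<sigma> by (rule alg_aut_hom[OF \<sigma>])
  have v: "vars (Y i ^ n :: 'k mpol) \<subseteq> {0..m}" if "i \<in> {1..m}" for i n
    using that vars_power[of "Y i :: 'k mpol" n] by auto
  have pow: "\<sigma> (cl (Y i ^ n)) = cl (Y (\<pi> i) ^ n)" if "i \<in> A" for i n
  proof (induction n)
    case (Suc n)
    have "i \<in> {1..m}" "\<pi> i \<in> {1..m}" using that A \<pi> by auto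
    then show ?case using Suc v[of i n] v[of "\<pi> i" n] \<sigma>Y[OF that] by (simp add: cl_mult)
  qed (simp add: cl_1)
  have "finite A" using A finite_subset by blast
  then show ?thesis using A \<pi> pow
  proof (induction A rule: finite_induct)
    case (insert i A)
    have w: "vars (\<Prod>j\<in>A. Y (f j) ^ e j :: 'k mpol) \<subseteq> {0..m}" if "f ` A \<subseteq> {1..m}" for f
      by (rule order_trans[OF vars_prod]) (use insert.hyps that v in blast)+
    show ?case
      using insert v[of i "e i"] v[of "\<pi> i" "e i"] w[of "\<lambda>i. i"] w[of \<pi>]
      by (simp add: cl_mult)
  qed (simp add: cl_1)
qed

end

section \<open>The action of one element of the symmetric group\<close>

locale danielewski_sym = danielewski +
  fixes \<sigma> \<pi>
  assumes k_ge_2: "\<And>j. j \<in> {2..m} \<Longrightarrow> k j \<ge> 2"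
    and aut: "\<sigma> \<in> alg_aut m k P"
    and \<sigma>_Z: "\<sigma> (cl Z) = cl Z"
    and \<pi>: "\<pi> permutes {1..m}"
    and k_\<pi>: "\<And>j. j \<in> {1..m} \<Longrightarrow> (k(1 := 1)) (\<pi> j) = (k(1 := 1)) j"
    and \<sigma>_Y: "\<And>i. i \<in> {1..m} \<Longrightarrow> \<sigma> (cl (Y i)) = cl (Y (\<pi> i))"
begin

sublocale \<sigma>: ring_hom_cring B B \<sigma> by (rule alg_aut_hom[OF aut])

lemma \<sigma>_Const: "\<sigma> (cl (Const c)) = cl (Const c)"
  using aut by (simp add: alg_aut_def)

text \<open>The exponent of Y_1 in the monomial is 1, all others are at least 2.\<close>

lemma \<pi>_1: "\<pi> 1 = 1"
proof (rule ccontr)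
  assume 1: "\<pi> 1 \<noteq> 1"
  have "\<pi> 1 \<in> {1..m}" using permutes_in_image[OF \<pi>, of 1] m_ge_1 by simp
  then have "k (\<pi> 1) \<ge> 2" using 1 by (intro k_ge_2) auto
  then show False using k_\<pi>[of 1] 1 m_ge_1 by simp
qed

lemma \<pi>_in: "j \<in> {2..m} \<Longrightarrow> \<pi> j \<in> {2..m}"
proof -
  assume j: "j \<in> {2..m}"
  have "\<pi> j \<noteq> 1" using j \<pi>_1 permutes_inj[OF \<pi>] by (auto dest: injD[of \<pi> j 1])
  moreover have "\<pi> j \<in> {1..m}" using permutes_in_image[OF \<pi>, of j] j by auto
  ultimately show "\<pi> j \<in> {2..m}" by auto
qed

text \<open>Since \<open>\<pi>\<close> fixes 1, the factor Y_1 can be cancelled from the invariance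
  of the whole monomial.\<close>

lemma \<sigma>_monomial: "\<sigma> (cl (\<Prod>j\<in>{2..m}. Y j ^ k j)) = cl (\<Prod>j\<in>{2..m}. Y j ^ k j)"
proof -
  have "Y 1 * (\<Prod>j\<in>{2..m}. Y (\<pi> j) ^ k j) = (Y 1 * (\<Prod>j\<in>{2..m}. Y j ^ k j) :: 'a mpol)"
    using permuted_monomial_eq_iff[OF m_ge_1 \<pi>, of k, where 'k = 'a] k_\<pi> \<pi>_1 by simp
  moreover have "Y 1 \<noteq> (0 :: 'a mpol)" by (metis vars_Var vars_0 insert_not_empty)
  ultimately have "(\<Prod>j\<in>{2..m}. Y (\<pi> j) ^ k j) = (\<Prod>j\<in>{2..m}. Y j ^ k j :: 'a mpol)" by simp
  moreover have "\<sigma> (cl (\<Prod>j\<in>{2..m}. Y j ^ k j)) = cl (\<Prod>j\<in>{2..m}. Y (\<pi> j) ^ k j)"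
    by (rule alg_aut_prod_Y[OF aut]) (use \<pi>_in \<sigma>_Y in force)+
  ultimately show ?thesis by simp
qed

text \<open>As \<open>\<pi>\<close> preserves \<open>{2..m}\<close>, the subring generated by the
  constants and y_2, ..., y_m is mapped into itself. Thus the image of \<open>h\<close> also has a
  representative to which the cancellation lemma applies.\<close>

lemma \<sigma>_Y2_subring:
  assumes "vars p \<subseteq> {2..m}"
  shows "\<exists>q. vars q \<subseteq> {2..m} \<and> \<sigma> (cl p) = cl q"
  using assms
proof (induction rule: mpol_induct)
  case (Const c)
  show ?case by (rule exI[of _ "Const c"]) (simp add: \<sigma>_Const)
next
  case (Var i)
  then show ?case using \<pi>_in \<sigma>_Y by (intro exI[of _ "Y (\<pi> i)"]) auto
next
  case (add p q)
  then obtain p' q' where *: "vars p' \<subseteq> {2..m}" "\<sigma> (cl p) = cl p'" "vars q' \<subseteq> {2..m}" "\<sigma> (cl q) = cl q'"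
    by blast
  moreover have "vars f \<subseteq> {0..m}" if "vars f \<subseteq> {2..m}" for f :: "'a mpol" using that by auto
  ultimately show ?case
    using add.hyps vars_add[of p' q'] by (intro exI[of _ "p' + q'"]) (auto simp: cl_add)
next
  case (mult p q)
  then obtain p' q' where *: "vars p' \<subseteq> {2..m}" "\<sigma> (cl p) = cl p'" "vars q' \<subseteq> {2..m}" "\<sigma> (cl q) = cl q'"
    by blast
  moreover have "vars f \<subseteq> {0..m}" if "vars f \<subseteq> {2..m}" for f :: "'a mpol" using that by auto
  ultimately show ?case
    using mult.hyps vars_mult[of p' q'] by (intro exI[of _ "p' * q'"]) (auto simp: cl_mult)
qed

end

section \<open>Multiples of the canonical derivation\<close>

text \<open>The parameter \<open>h0\<close> is a polynomial representative of \<open>h\<close>, kept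
  because the degree argument takes place among polynomials.\<close>

locale danielewski_sym_der = danielewski_sym +
  fixes D h h0
  assumes D: "is_D_con m k P D"
    and h0: "vars h0 \<subseteq> {2..m}"
    and h: "h = cl h0"
begin

definition \<delta> where "\<delta> b = h \<otimes>\<^bsub>B\<^esub> D b"

lemma D_closed [simp]: "b \<in> carrier B \<Longrightarrow> D b \<in> carrier B"
  using D by (auto simp: is_D_con_def derivation_def Let_def)

lemma D_add: "a \<in> carrier B \<Longrightarrow> b \<in> carrier B \<Longrightarrow> D (a \<oplus>\<^bsub>B\<^esub> b) = D a \<oplus>\<^bsub>B\<^esub> D b"
  using D by (auto simp: is_D_con_def derivation_def Let_def)

lemma D_mult: "a \<in> carrier B \<Longrightarrow> b \<in> carrier B \<Longrightarrow>
    D (a \<otimes>\<^bsub>B\<^esub> b) = (D a \<otimes>\<^bsub>B\<^esub> b) \<oplus>\<^bsub>B\<^esub> (a \<otimes>\<^bsub>B\<^esub> D b)"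
  using D by (auto simp: is_D_con_def derivation_def Let_def)

lemma D_Const: "D (cl (Const c)) = \<zero>\<^bsub>B\<^esub>"
proof -
  \<comment> \<open>The Leibniz rule for 1 = 1 * 1 kills 1; linearity over the constants then kills
    every constant.\<close>
  have "D \<one>\<^bsub>B\<^esub> = D \<one>\<^bsub>B\<^esub> \<oplus>\<^bsub>B\<^esub> D \<one>\<^bsub>B\<^esub>"
    using D_mult[of "\<one>\<^bsub>B\<^esub>" "\<one>\<^bsub>B\<^esub>"] by simp
  then have "D \<one>\<^bsub>B\<^esub> = \<zero>\<^bsub>B\<^esub>" by simp
  moreover have "D (cl (Const c) \<otimes>\<^bsub>B\<^esub> \<one>\<^bsub>B\<^esub>) = cl (Const c) \<otimes>\<^bsub>B\<^esub> D \<one>\<^bsub>B\<^esub>"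
    using D B.one_closed unfolding is_D_con_def derivation_def Let_def by blast
  ultimately show ?thesis by simp
qed

lemma D_Y1: "D (cl (Y 1)) = cl (subst_Z (pderiv P))"
  and D_Z: "D (cl Z) = cl (\<Prod>j\<in>{2..m}. Y j ^ k j)"
  and D_Y: "j \<in> {2..m} \<Longrightarrow> D (cl (Y j)) = \<zero>\<^bsub>B\<^esub>"
  using D by (auto simp: is_D_con_def)

lemma h_closed [simp]: "h \<in> carrier B"
  unfolding h by (rule cl_closed) (use h0 in auto)

lemma \<delta>_closed [simp]: "b \<in> carrier B \<Longrightarrow> \<delta> b \<in> carrier B"
  by (simp add: \<delta>_def)

text \<open>The common core of the computations at y_1 and at z, where \<open>r\<close> represents
  P'(z) and the monomial D(z) respectively.\<close>

lemma h_cancel: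
  assumes "vars r \<subseteq> {0..m}" and "r \<noteq> 0"
    and "\<And>t. t \<in> Poly_Mapping.keys r \<Longrightarrow> Poly_Mapping.lookup t 0 < degree P"
  shows "h \<otimes>\<^bsub>B\<^esub> cl r = \<sigma> h \<otimes>\<^bsub>B\<^esub> cl r \<longleftrightarrow> \<sigma> h = h"
proof -
  obtain q where q: "vars q \<subseteq> {2..m}" "\<sigma> h = cl q"
    using \<sigma>_Y2_subring[OF h0] h by auto
  show ?thesis
    by (rule trans[OF cl_mult_right_cancel[OF h0 q(1) assms, folded q(2) h] eq_commute])
qed

lemma commute_Y1_iff:
  assumes "pderiv P \<noteq> 0"
  shows "\<delta> (\<sigma> (cl (Y 1))) = \<sigma> (\<delta> (cl (Y 1))) \<longleftrightarrow> \<sigma> h = h"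
proof -
  have v: "vars (subst_Z (pderiv P)) \<subseteq> {0..m}" using vars_subst_Z by fastforce
  have "degree (pderiv P) < degree P"
  proof (cases "degree P = 0")
    case True
    then show ?thesis using assms by (auto elim!: degree_eq_zeroE)
  next
    case False
    \<comment> \<open>Proved coefficientwise as an inequality: in a domain of positive
      characteristic the degree may drop further.\<close>
    have "degree (pderiv P) \<le> degree P - 1"
      by (rule degree_le) (simp add: coeff_pderiv coeff_eq_0)
    with False show ?thesis by simp
  qed
  then have "Poly_Mapping.lookup t 0 < degree P" if "t \<in> Poly_Mapping.keys (subst_Z (pderiv P))" for t
    using that keys_subst_Z[of "pderiv P"] by auto
  from h_cancel[OF v _ this] show ?thesis
    using assms v m_ge_1
    by (simp add: \<delta>_def \<sigma>_Y \<pi>_1 D_Y1 alg_aut_subst_Z[OF aut \<sigma>_Z] del: One_nat_def)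
qed

lemma commute_Z_iff:
  assumes "degree P \<noteq> 0"
  shows "\<delta> (\<sigma> (cl Z)) = \<sigma> (\<delta> (cl Z)) \<longleftrightarrow> \<sigma> h = h"
proof -
  define M where "M = (\<Prod>j\<in>{2..m}. Y j ^ k j :: 'a mpol)"
  have v: "vars M \<subseteq> {2..m}" unfolding M_def by (rule vars_prod_Y) auto
  then have v': "vars M \<subseteq> {0..m}" by auto
  \<comment> \<open>\<open>M\<close> is a single term with coefficient 1.\<close>
  have M0: "M \<noteq> 0" unfolding M_def prod_Var_power by (metis keys_single keys_zero insert_not_empty one_neq_zero)
  have "Poly_Mapping.lookup t 0 < degree P" if "t \<in> Poly_Mapping.keys M" for t
  proof -
    have "0 \<notin> Poly_Mapping.keys t" using that v by (force simp: vars_def)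
    then show ?thesis using assms by (simp add: in_keys_iff)
  qed
  from h_cancel[OF v' M0 this] show ?thesis
    using v' \<sigma>_monomial by (simp add: \<delta>_def \<sigma>_Z D_Z flip: M_def)
qed

text \<open>Commutation at z alone already forces \<open>h\<close> to be fixed. Conversely,
  commutation on the generators extends to sums by additivity and to products by the Leibniz
  rule.\<close>

lemma in_Aut_der_iff:
  assumes "degree P \<noteq> 0"
  shows "\<sigma> \<in> Aut_der m k P \<delta> \<longleftrightarrow> \<sigma> h = h"
proof
  assume "\<sigma> \<in> Aut_der m k P \<delta>"
  then have "\<delta> (\<sigma> (cl Z)) = \<sigma> (\<delta> (cl Z))" by (simp add: Aut_der_def)
  then show "\<sigma> h = h" using commute_Z_iff[OF assms] by simp
next
  assume \<sigma>h: "\<sigma> h = h"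
  have D\<sigma>: "\<delta> (\<sigma> b) = \<sigma> (\<delta> b)" if "b \<in> carrier B" for b
    using that
  proof (induction rule: coord_ring_induct)
    case (Const c)
    show ?case by (simp add: \<delta>_def \<sigma>_Const D_Const)
  next
    case Z
    show ?case using commute_Z_iff[OF assms] \<sigma>h by simp
  next
    case (Y j)
    have "vars (subst_Z (pderiv P)) \<subseteq> {0..m}" using vars_subst_Z by fastforce
    then have "j = 1 \<Longrightarrow> ?case"
      using m_ge_1 \<sigma>h
      by (simp add: \<delta>_def \<sigma>_Y \<pi>_1 D_Y1 alg_aut_subst_Z[OF aut \<sigma>_Z] del: One_nat_def)
    \<comment> \<open>Both sides vanish, since \<open>\<pi> j\<close> again lies in
      \<open>{2..m}\<close> and \<open>D\<close> kills these generators.\<close>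
    moreover have "j \<in> {2..m} \<Longrightarrow> ?case"
      using \<pi>_in[of j] by (simp add: \<delta>_def \<sigma>_Y D_Y)
    moreover have "j = 1 \<or> j \<in> {2..m}" using Y by auto
    ultimately show ?case by blast
  next
    case (add a b)
    then show ?case by (simp add: \<delta>_def D_add B.r_distr)
  next
    case (mult a b)
    \<comment> \<open>A multiple of a derivation again satisfies the Leibniz rule.\<close>
    have \<delta>_mult: "\<delta> (a \<otimes>\<^bsub>B\<^esub> b) = (\<delta> a \<otimes>\<^bsub>B\<^esub> b) \<oplus>\<^bsub>B\<^esub> (a \<otimes>\<^bsub>B\<^esub> \<delta> b)"
      if "a \<in> carrier B" "b \<in> carrier B" for a b
      using that by (simp add: \<delta>_def D_mult B.r_distr B.m_assoc B.m_lcomm)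
    show ?case using mult by (simp add: \<delta>_mult)
  qed
  then show "\<sigma> \<in> Aut_der m k P \<delta>" using aut by (simp add: Aut_der_def)
qed

end

section \<open>The group structure of the symmetric group\<close>

context danielewski
begin

text \<open>The permutation of the composite is \<open>\<pi>f \<circ> \<pi>g\<close>. That the
  composite is an algebra automorphism will come from the subgroup property of
  \<open>Aut_der\<close>.\<close>

lemma sym_grp_compose:
  assumes "f \<in> sym_grp m k P" "g \<in> sym_grp m k P" and "compose (carrier B) f g \<in> alg_aut m k P"
  shows "compose (carrier B) f g \<in> sym_grp m k P"
proof -
  obtain \<pi>f where f: "f \<in> alg_aut m k P" "f (cl Z) = cl Z" "\<pi>f permutes {1..m}"
    "\<forall>j\<in>{1..m}. (k(1 := 1)) (\<pi>f j) = (k(1 := 1)) j"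
    "\<forall>i\<in>{1..m}. f (cl (Y i)) = cl (Y (\<pi>f i))"
    using assms(1) by (rule sym_grpE)
  obtain \<pi>g where g: "g \<in> alg_aut m k P" "g (cl Z) = cl Z" "\<pi>g permutes {1..m}"
    "\<forall>j\<in>{1..m}. (k(1 := 1)) (\<pi>g j) = (k(1 := 1)) j"
    "\<forall>i\<in>{1..m}. g (cl (Y i)) = cl (Y (\<pi>g i))"
    using assms(2) by (rule sym_grpE)
  have in_g: "\<pi>g j \<in> {1..m}" if "j \<in> {1..m}" for j
    using permutes_in_image[OF g(3)] that by blast
  show ?thesis
    unfolding sym_grp_iff
  proof (intro conjI exI[of _ "\<pi>f \<circ> \<pi>g"] ballI)
    show "(k(1 := 1)) ((\<pi>f \<circ> \<pi>g) j) = (k(1 := 1)) j" if "j \<in> {1..m}" for j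
      using bspec[OF f(4) in_g[OF that]] bspec[OF g(4) that] by (simp only: comp_apply)
    show "compose (carrier B) f g (cl (Y i)) = cl (Y ((\<pi>f \<circ> \<pi>g) i))" if "i \<in> {1..m}" for i
    proof -
      have "cl (Y i) \<in> carrier B" using that by simp
      then show ?thesis using bspec[OF f(5) in_g[OF that]] bspec[OF g(5) that] by (simp only: compose_eq comp_apply)
    qed
  qed (use assms(3) f(2,3) g(2,3) in \<open>simp_all add: compose_eq permutes_compose\<close>)
qed

lemma sym_grp_inverse:
  assumes "f \<in> sym_grp m k P" and "(\<lambda>b\<in>carrier B. inv_into (carrier B) f b) \<in> alg_aut m k P"
  shows "(\<lambda>b\<in>carrier B. inv_into (carrier B) f b) \<in> sym_grp m k P" (is "?g \<in> _")
proof -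
  obtain \<pi> where \<pi>: "f \<in> alg_aut m k P" "f (cl Z) = cl Z" "\<pi> permutes {1..m}"
    "\<forall>j\<in>{1..m}. (k(1 := 1)) (\<pi> j) = (k(1 := 1)) j"
    "\<forall>i\<in>{1..m}. f (cl (Y i)) = cl (Y (\<pi> i))"
    using assms(1) by (rule sym_grpE)
  have "f \<in> Bij (carrier B)" using \<pi>(1) by (simp add: alg_aut_def)
  then have inj: "inj_on f (carrier B)" and f_closed: "\<And>a. a \<in> carrier B \<Longrightarrow> f a \<in> carrier B"
    by (auto simp: Bij_def bij_betw_def)
  \<comment> \<open>To evaluate the inverse at \<open>b\<close> it suffices to exhibit a preimage of
    \<open>b\<close> in the carrier.\<close>
  have gI: "?g b = a" if "a \<in> carrier B" "f a = b" for a b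
    using that(1) f_closed[OF that(1)] inv_into_f_f[OF inj that(1)] unfolding that(2)[symmetric] by simp
  define \<rho> where "\<rho> = inv_into UNIV \<pi>"
  have \<rho>: "\<rho> permutes {1..m}" unfolding \<rho>_def by (rule permutes_inv[OF \<pi>(3)])
  have in_\<rho>: "\<rho> j \<in> {1..m}" if "j \<in> {1..m}" for j
    using permutes_in_image[OF \<rho>] that by blast
  have \<pi>\<rho>: "\<pi> (\<rho> j) = j" for j unfolding \<rho>_def by (rule permutes_inverses(1)[OF \<pi>(3)])
  show ?thesis
    unfolding sym_grp_iff
  proof (intro conjI exI[of _ \<rho>] ballI)
    show "?g (cl Z) = cl Z" by (rule gI) (use \<pi>(2) in simp_all)
    show "(k(1 := 1)) (\<rho> j) = (k(1 := 1)) j" if "j \<in> {1..m}" for j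
      using bspec[OF \<pi>(4) in_\<rho>[OF that]] by (simp only: \<pi>\<rho>)
    show "?g (cl (Y i)) = cl (Y (\<rho> i))" if "i \<in> {1..m}" for i
    proof (rule gI)
      show "cl (Y (\<rho> i)) \<in> carrier B" using in_\<rho>[OF that] by simp
      show "f (cl (Y (\<rho> i))) = cl (Y i)" using bspec[OF \<pi>(5) in_\<rho>[OF that]] by (simp only: \<pi>\<rho>)
    qed
  qed (fact assms(2), fact \<rho>)
qed

lemma sym_grp_one:
  assumes "(\<lambda>b\<in>carrier B. b) \<in> alg_aut m k P"
  shows "(\<lambda>b\<in>carrier B. b) \<in> sym_grp m k P"
  unfolding sym_grp_iff using assms by (auto intro!: exI[of _ id] simp: permutes_id)

text \<open>Closure is checked in the group of all bijections of the carrier, where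
  \<open>Aut_der\<close> is a subgroup containing \<open>sym_grp\<close>; the result then restricts
  to \<open>Aut_der_group\<close>.\<close>

lemma subgroup_sym_grp:
  assumes "sym_grp m k P \<subseteq> Aut_der m k P \<delta>" and "\<delta> \<in> carrier B \<rightarrow> carrier B"
  shows "subgroup (sym_grp m k P) (Aut_der_group m k P \<delta>)"
proof -
  define G where "G = BijGroup (carrier B)"
  interpret G: group G unfolding G_def by (rule group_BijGroup)
  have A: "subgroup (Aut_der m k P \<delta>) G"
    unfolding G_def by (rule Aut_der_subgroup[OF m_ge_1 assms(2)])
  have aut: "f \<in> alg_aut m k P" if "f \<in> Aut_der m k P \<delta>" for f
    using that by (simp add: Aut_der_def)
  have bij: "f \<in> Bij (carrier B)" if "f \<in> sym_grp m k P" for f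
    using that by (auto simp: sym_grp_def alg_aut_def)
  have "subgroup (sym_grp m k P) G"
  proof (rule subgroup.intro)
    show "sym_grp m k P \<subseteq> carrier G" using bij by (auto simp: G_def BijGroup_def)
  next
    fix f g assume fg: "f \<in> sym_grp m k P" "g \<in> sym_grp m k P"
    have "f \<otimes>\<^bsub>G\<^esub> g = compose (carrier B) f g"
      using fg bij by (simp add: G_def BijGroup_def)
    moreover have "f \<otimes>\<^bsub>G\<^esub> g \<in> alg_aut m k P"
      using fg assms(1) subgroup.m_closed[OF A] aut by blast
    ultimately show "f \<otimes>\<^bsub>G\<^esub> g \<in> sym_grp m k P" using sym_grp_compose[OF fg] by simp
  next
    have "\<one>\<^bsub>G\<^esub> = (\<lambda>b\<in>carrier B. b)" by (simp add: G_def BijGroup_def)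
    then show "\<one>\<^bsub>G\<^esub> \<in> sym_grp m k P"
      using sym_grp_one aut subgroup.one_closed[OF A] by simp
  next
    fix f assume f: "f \<in> sym_grp m k P"
    have "inv\<^bsub>G\<^esub> f = (\<lambda>b\<in>carrier B. inv_into (carrier B) f b)"
      unfolding G_def by (rule inv_BijGroup[OF bij[OF f]])
    moreover have "inv\<^bsub>G\<^esub> f \<in> alg_aut m k P"
      using f assms(1) subgroup.m_inv_closed[OF A] aut by blast
    ultimately show "inv\<^bsub>G\<^esub> f \<in> sym_grp m k P" using sym_grp_inverse[OF f] by simp
  qed
  then show ?thesis
    unfolding Aut_der_group_def G_def[symmetric]
    by (rule G.subgroup_incl[OF _ A assms(1)])
qed

end

section \<open>The equivalences and the case of a nonzero constant factor\<close>

theorem lemma5p6: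
  fixes m d :: nat
    and k :: "nat \<Rightarrow> nat"
    and P :: "'k::{alg_closed_field, field_char_0} poly"
    and D \<delta> :: "'k mpol set \<Rightarrow> 'k mpol set"
    and h :: "'k mpol set"
  assumes "m \<ge> 2" and "d \<ge> 2" and "\<forall>j\<in>{2..m}. k j \<ge> 2"
    and "degree P = d" and "lead_coeff P = 1"
    and "is_D_con m k P D"
    and "h \<in> cls m k P ` {p. vars p \<subseteq> {2..m}}"
    and "\<delta> = (\<lambda>b. h \<otimes>\<^bsub>coord_ring m k P\<^esub> D b)"
  shows "(\<forall>\<sigma>\<in>sym_grp m k P.
            (\<delta> (\<sigma> (cls m k P (Y 1))) = \<sigma> (\<delta> (cls m k P (Y 1))) \<longleftrightarrow> \<sigma> h = h) \<and>
            (\<sigma> h = h \<longleftrightarrow> \<delta> (\<sigma> (cls m k P Z)) = \<sigma> (\<delta> (cls m k P Z))) \<and>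
            (\<delta> (\<sigma> (cls m k P Z)) = \<sigma> (\<delta> (cls m k P Z)) \<longleftrightarrow> \<sigma> \<in> Aut_der m k P \<delta>)) \<and>
         (h \<in> cls m k P ` Const ` (UNIV - {0}) \<longrightarrow>
            sym_grp m k P = sym_grp m k P \<inter> Aut_der m k P \<delta> \<and>
            subgroup (sym_grp m k P) (Aut_der_group m k P \<delta>))"
proof -
  interpret danielewski m k P using assms(1) by unfold_locales simp
  obtain h0 where h0: "vars h0 \<subseteq> {2..m}" "h = cl h0" using assms(7) by blast
  \<comment> \<open>In characteristic zero only constant polynomials have zero derivative.\<close>
  have deg: "degree P \<noteq> 0" and pderiv: "pderiv P \<noteq> 0"
    using assms(2,4) by (simp_all add: pderiv_eq_0_iff)
  \<comment> \<open>Conditions (a), (c) and (d) are each compared with (b), which yields the whole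
    chain.\<close>
  have key: "(\<delta> (\<sigma> (cl (Y 1))) = \<sigma> (\<delta> (cl (Y 1))) \<longleftrightarrow> \<sigma> h = h) \<and>
      (\<delta> (\<sigma> (cl Z)) = \<sigma> (\<delta> (cl Z)) \<longleftrightarrow> \<sigma> h = h) \<and> (\<sigma> \<in> Aut_der m k P \<delta> \<longleftrightarrow> \<sigma> h = h)"
    if \<sigma>: "\<sigma> \<in> sym_grp m k P" for \<sigma>
  proof -
    obtain \<pi> where \<pi>: "\<sigma> \<in> alg_aut m k P" "\<sigma> (cl Z) = cl Z" "\<pi> permutes {1..m}"
      "\<forall>j\<in>{1..m}. (k(1 := 1)) (\<pi> j) = (k(1 := 1)) j"
      "\<forall>i\<in>{1..m}. \<sigma> (cl (Y i)) = cl (Y (\<pi> i))"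
      using \<sigma> by (rule sym_grpE)
    interpret S: danielewski_sym_der m k P \<sigma> \<pi> D h h0
      by unfold_locales (use assms(3) \<pi>(4,5) in blast | fact \<pi> h0 assms(6))+
    have "\<delta> = S.\<delta>" using assms(8) by (simp add: S.\<delta>_def fun_eq_iff)
    then show ?thesis
      using S.commute_Y1_iff[OF pderiv] S.commute_Z_iff[OF deg] S.in_Aut_der_iff[OF deg] by simp
  qed
  moreover have "subgroup (sym_grp m k P) (Aut_der_group m k P \<delta>) \<and> sym_grp m k P \<subseteq> Aut_der m k P \<delta>"
    if "h \<in> cl ` Const ` (UNIV - {0})"
  proof -
    \<comment> \<open>Algebra automorphisms fix the classes of constants, so (b) holds for the whole
      symmetric group.\<close>
    have "\<sigma> h = h" if "\<sigma> \<in> sym_grp m k P" for \<sigma>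
      using that \<open>h \<in> cl ` Const ` (UNIV - {0})\<close> by (auto simp: sym_grp_def alg_aut_def)
    then have sub: "sym_grp m k P \<subseteq> Aut_der m k P \<delta>" using key by blast
    have "D \<in> carrier B \<rightarrow> carrier B" using assms(6) by (auto simp: is_D_con_def derivation_def Let_def)
    moreover have "h \<in> carrier B" unfolding h0(2) by (rule cl_closed) (use h0(1) in auto)
    ultimately have "\<delta> \<in> carrier B \<rightarrow> carrier B" by (auto simp: assms(8))
    with sub show ?thesis by (simp add: subgroup_sym_grp)
  qed
  ultimately show ?thesis by blast
qed

end
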